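(* Let $\{a(n)\}_{n\in\mathbb{N}}$ be a sequence of complex numbers satisfying (1) $a(n)=O(n^{\alpha})$; (2) $\sum_{n\le X} a(n)\ll X^{\beta}$; (3) $\sum_{n\le X}|a(n)|^2=c_1X^{\gamma_1}+O(X^{\eta_1})$, where $\alpha,\beta,c_1,\gamma_1,\eta_1$ are positive real constants. (First part.) Let $\theta_1,\theta_2\in\mathbb{R}$ with $0\le\theta_2-\theta_1<\pi$, and let $\mathcal{W}(\theta_1,\theta_2)=\{\rho e^{i\theta}:\rho>0,\ \theta\in[\theta_1,\theta_2]\}$. Then for any $r$ satisfying $$\max(\alpha+\beta,\eta_1)-(\gamma_1-1)<r<1,$$ the sequence $\{a(n)\}_{n\in\mathbb{N}}$ has at least one term outside of $\mathcal{W}(\theta_1,\theta_2)$ for some $n\in(X,X+X^r]$, for all $X\gg1$. (Second part.) Suppose also that $\{a(n)\}_{n\in\mathbb{N}}$ satisfies the additional condition (4) $\sum_{n\le X}a(n)^2=c_2X^{\gamma_2}+O(X^{\eta_2})$, where $\gamma_2$ and $\eta_2$ are positive real constants and $c_2$ is possibly complex, and that $\alpha+\beta<\max(\gamma_1,\gamma_2)$. Let $r$ be such that $$\max(\alpha+\beta,\eta_2,\eta_1)-(\max(\gamma_2,\gamma_1)-1)<r<1.$$ If $\operatorname{Re}(c_2)X^{\gamma_2}\ne -c_1X^{\gamma_1}$ (resp. if $\operatorname{Re}(c_2)X^{\gamma_2}\ne c_1X^{\gamma_1}$), then the sequence $\{\operatorname{Re}(a(n))\}_{n\in\mathbb{N}}$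 (resp. $\{\operatorname{Im}(a(n))\}_{n\in\mathbb{N}}$) has at least one sign change in the interval $(X,X+X^r]$ for $X\gg1$.
   Context: $X$ denotes a real variable, the asymptotic conditions are as $X\to\infty$ (resp. $n\to\infty$), and "for $X\gg1$" means for all sufficiently large $X$. The conditions $\operatorname{Re}(c_2)X^{\gamma_2}\ne\pm c_1X^{\gamma_1}$ are understood as saying that the two sides are not identical as functions of $X$. A real sequence $\{x(n)\}$ has at least one sign change in an interval $I$ if there are integers $n,m\in I$ with $x(n)>0$ and $x(m)<0$.
   Formalization: In the second part, if c_2 = 0 then gamma_2 <= gamma_1 is also assumed; without this the claim fails, e.g. for a(n) = i^n, c_1 = gamma_1 = 1, c_2 = 0, gamma_2 = 10, r = -1. *)

theory Defs
  imports Complex_Main "HOL-Library.Landau_Symbols"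
begin

text \<open>
  Sequences indexed by the positive integers are functions on \<^typ>\<open>nat\<close> whose value at 0 is
  never used: partial sums start at 1.
\<close>

definition summatory :: "(nat \<Rightarrow> 'a::comm_monoid_add) \<Rightarrow> real \<Rightarrow> 'a" where
  "summatory f X = (\<Sum>n | 1 \<le> n \<and> real n \<le> X. f n)"

text \<open>The vertex 0 does not belong to the sector.\<close>

definition sector :: "real \<Rightarrow> real \<Rightarrow> complex set" where
  "sector \<theta>1 \<theta>2 = {of_real \<rho> * exp (\<i> * of_real \<theta>) | \<rho> \<theta>. \<rho> > 0 \<and> \<theta> \<in> {\<theta>1..\<theta>2}}"

definition has_sign_change :: "(nat \<Rightarrow> real) \<Rightarrow> real set \<Rightarrow> bool" where
  "has_sign_change x I \<longleftrightarrow> (\<exists>n m. real n \<in> I \<and> real m \<in> I \<and> x n > 0 \<and> x m < 0)"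

end

theory Submission imports Defs "HOL-Real_Asymp.Real_Asymp" begin

text \<open>
  If all terms in \<open>(X, X + X\<^sup>r]\<close> lay in a sector of angle less than \<open>\<pi>\<close>, there would be no
  essential cancellation in their sum, so that the sum of \<open>|a(n)|\<close> would be \<open>O(X\<^sup>\<beta>)\<close> and the sum of
  \<open>|a(n)|\<^sup>2\<close> would be \<open>O(X\<^bsup>\<alpha>+\<beta>\<^esup>)\<close>. But condition (3) makes the latter grow like \<open>X\<^bsup>\<gamma>\<^sub>1-1+r\<^esup>\<close>. Real and
  imaginary parts are handled in the same way, with \<open>2 Re(a)\<^sup>2 = |a|\<^sup>2 + Re(a\<^sup>2)\<close> and
  \<open>2 Im(a)\<^sup>2 = |a|\<^sup>2 - Re(a\<^sup>2)\<close>; the case \<open>\<gamma>\<^sub>2 > \<gamma>\<^sub>1\<close> is void, as \<open>|\<Sum> a(n)\<^sup>2| \<le> \<Sum> |a(n)|\<^sup>2\<close>.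
\<close>

section \<open>Sums over the short intervals \<open>(X, X + X powr r]\<close>\<close>

definition short_sum :: "real \<Rightarrow> (nat \<Rightarrow> 'a::comm_monoid_add) \<Rightarrow> real \<Rightarrow> 'a" where
  "short_sum r f X = (\<Sum>n | real n \<in> {X<..X + X powr r}. f n)"

lemma finite_nat_real_le: "finite {n. P n \<and> real n \<le> Y}"
proof (rule finite_subset)
  show "{n. P n \<and> real n \<le> Y} \<subseteq> {..nat \<lfloor>Y\<rfloor>}"
    by (auto simp: le_nat_floor)
qed simp

lemma short_sum_eq_diff:
  fixes f :: "nat \<Rightarrow> 'a::ab_group_add"
  assumes "X \<ge> 0"
  shows "short_sum r f X = summatory f (X + X powr r) - summatory f X"
proof -
  let ?A = "{n. 1 \<le> n \<and> real n \<le> X + X powr r}" and ?B = "{n. 1 \<le> n \<and> real n \<le> X}"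
  have "?B \<subseteq> ?A"
    by (smt (verit) Collect_mono powr_ge_zero)
  moreover have "{n. real n \<in> {X<..X + X powr r}} = ?A - ?B"
    \<comment> \<open>For \<open>X \<ge> 0\<close> the left-open interval excludes the index 0, in
      accordance with partial sums starting at 1.\<close>
    using assms by (auto simp: Suc_le_eq intro!: gr0I)
  ultimately show ?thesis
    unfolding short_sum_def summatory_def by (simp add: sum_diff finite_nat_real_le)
qed

lemma short_sum_nonneg:
  fixes f :: "nat \<Rightarrow> real"
  assumes "\<And>n. f n \<ge> 0"
  shows "short_sum r f X \<ge> 0"
  unfolding short_sum_def by (intro sum_nonneg assms)

section \<open>Asymptotics of short sums\<close>

text \<open>As \<open>r < 1\<close>, the right endpoint \<open>X + X powr r\<close> is asymptotic to
  \<open>X\<close>, so an error term at either endpoint can be measured by the same power of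
  \<open>X\<close>.\<close>

lemma bigo_powr_short_shift:
  fixes g :: "real \<Rightarrow> 'a::real_normed_field" and r \<eta> :: real
  assumes "g \<in> O(\<lambda>X. of_real (X powr \<eta>))" "r < 1"
  shows "(\<lambda>X. g (X + X powr r)) \<in> O(\<lambda>X. of_real (X powr \<eta>))"
proof -
  have lim: "filterlim (\<lambda>X::real. X + X powr r) at_top at_top"
    using assms(2) by real_asymp
  have "(\<lambda>X. (X + X powr r) powr \<eta>) \<in> O(\<lambda>X. X powr \<eta>)"
    using assms(2) by real_asymp
  then have "(\<lambda>X. of_real ((X + X powr r) powr \<eta>) :: 'a) \<in> O(\<lambda>X. of_real (X powr \<eta>))"
    by (simp add: landau_o.big.of_real_iff)
  with landau_o.big.compose[OF assms(1) lim] show ?thesis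
    using landau_o.big_trans by blast
qed

text \<open>The main term changes over the interval by about its derivative times the length, that
  is \<open>A * \<gamma> * X powr (\<gamma> - 1 + r)\<close>, while both endpoint errors are
  \<open>o(X powr s)\<close>. Allowing \<open>s\<close> to exceed \<open>\<gamma> - 1 + r\<close>
  lets sums with different exponents \<open>\<gamma>\<close> be normalised by one common
  power.\<close>

lemma short_sum_powr_limit:
  fixes f :: "nat \<Rightarrow> real" and A \<gamma> \<eta> r s :: real
  assumes f: "(\<lambda>X. summatory f X - A * X powr \<gamma>) \<in> O(\<lambda>X. X powr \<eta>)"
    and r: "r < 1" and \<eta>: "\<eta> < s" and s: "\<gamma> - 1 + r \<le> s"
  shows "((\<lambda>X. short_sum r f X / X powr s) \<longlongrightarrow> (if s = \<gamma> - 1 + r then A * \<gamma> else 0)) at_top"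
proof -
  define e where "e X = summatory f X - A * X powr \<gamma>" for X
  have e: "e \<in> O(\<lambda>X. X powr \<eta>)"
    using f unfolding e_def .
  have "(\<lambda>X. e (X + X powr r) - e X) \<in> O(\<lambda>X. X powr \<eta>)"
    using bigo_powr_short_shift[of e \<eta> r] e r by (intro sum_in_bigo) simp_all
  also have "(\<lambda>X. X powr \<eta>) \<in> o(\<lambda>X. X powr s)"
    using \<eta> by real_asymp
  finally have err: "((\<lambda>X. (e (X + X powr r) - e X) / X powr s) \<longlongrightarrow> 0) at_top"
    by (rule smalloD_tendsto)
  have main: "((\<lambda>X. ((X + X powr r) powr \<gamma> - X powr \<gamma>) / X powr (\<gamma> - 1 + r)) \<longlongrightarrow> \<gamma>) at_top"
    using r by real_asymp
  have "((\<lambda>X. ((X + X powr r) powr \<gamma> - X powr \<gamma>) / X powr s)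
          \<longlongrightarrow> (if s = \<gamma> - 1 + r then \<gamma> else 0)) at_top"
  proof (cases "s = \<gamma> - 1 + r")
    case True
    with main show ?thesis by simp
  next
    case False
    with s have "\<gamma> - 1 + r < s" by simp
    then have "((\<lambda>X. X powr (\<gamma> - 1 + r) / X powr s) \<longlongrightarrow> 0) at_top"
      by real_asymp
    from tendsto_mult[OF main this]
    have "((\<lambda>X. ((X + X powr r) powr \<gamma> - X powr \<gamma>) / X powr (\<gamma> - 1 + r)
              * (X powr (\<gamma> - 1 + r) / X powr s)) \<longlongrightarrow> 0) at_top"
      by simp
    then have "((\<lambda>X. ((X + X powr r) powr \<gamma> - X powr \<gamma>) / X powr s) \<longlongrightarrow> 0) at_top"
      by (rule Lim_transform_eventually)
         (use eventually_gt_at_top[of 0] in eventually_elim, simp)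
    with False show ?thesis by simp
  qed
  from tendsto_add[OF tendsto_mult[OF tendsto_const[of A] this] err]
  have "((\<lambda>X. A * (((X + X powr r) powr \<gamma> - X powr \<gamma>) / X powr s)
            + (e (X + X powr r) - e X) / X powr s)
          \<longlongrightarrow> (if s = \<gamma> - 1 + r then A * \<gamma> else 0)) at_top"
    by (simp split: if_splits)
  then show ?thesis
  proof (rule Lim_transform_eventually)
    show "\<forall>\<^sub>F X in at_top. A * (((X + X powr r) powr \<gamma> - X powr \<gamma>) / X powr s)
            + (e (X + X powr r) - e X) / X powr s = short_sum r f X / X powr s"
      using eventually_ge_at_top[of 0]
      by eventually_elim (simp add: short_sum_eq_diff e_def diff_divide_distrib right_diff_distrib)
  qed
qed

section \<open>Forced cancellation in short sums\<close>

text \<open>If the inequality failed, the sum of squared norms would be at most the largest norm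
  times the sum of norms, hence bounded by a term of order
  \<open>X powr (\<alpha> + \<beta>)\<close>, which is too small for the limit \<open>L\<close>. The
  factor \<open>K\<close> measures how much cancellation is excluded: 1 for sequences of constant
  sign, a larger constant for a sector.\<close>

lemma short_sum_norm_gt_norm_short_sum:
  fixes b :: "nat \<Rightarrow> 'a::real_normed_field" and \<alpha> \<beta> r s K L :: real
  assumes \<alpha>: "\<alpha> \<ge> 0" and r: "r < 1" and s: "\<alpha> + \<beta> < s" and L: "L \<noteq> 0"
    and bound: "b \<in> O(\<lambda>n. of_real (real n powr \<alpha>))"
    and sum: "summatory b \<in> O(\<lambda>X. of_real (X powr \<beta>))"
    and lim: "((\<lambda>X. short_sum r (\<lambda>n. (norm (b n))\<^sup>2) X / X powr s) \<longlongrightarrow> L) at_top"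
  shows "\<forall>\<^sub>F X in at_top. K * norm (short_sum r b X) < short_sum r (\<lambda>n. norm (b n)) X"
proof -
  \<comment> \<open>A limit of nonnegative quotients is nonnegative, so \<open>L \<noteq> 0\<close>
    already gives positivity.\<close>
  have "L \<ge> 0"
    using lim
    by (rule tendsto_lowerbound) (auto intro!: always_eventually divide_nonneg_nonneg short_sum_nonneg)
  with L have "L > 0" by simp
  obtain C where "C > 0"
    and C: "\<forall>\<^sub>F n in at_top. norm (b n) \<le> C * norm (of_real (real n powr \<alpha>) :: 'a)"
    using landau_o.bigE[OF bound] by blast
  then obtain N where N: "\<And>n. n \<ge> N \<Longrightarrow> norm (b n) \<le> C * real n powr \<alpha>"
    by (auto simp: eventually_at_top_linorder)
  \<comment> \<open>\<open>G X\<close> is what bounds the sum of squared norms when the claim fails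
    at \<open>X\<close>. Differences of partial sums replace the short sum, so that the bound on
    \<open>summatory b\<close> applies at both endpoints.\<close>
  define G where "G X = C * (X + X powr r) powr \<alpha> *
    (K * norm (summatory b (X + X powr r) - summatory b X))" for X
  have 1: "(\<lambda>X. (X + X powr r) powr \<alpha>) \<in> O(\<lambda>X. X powr \<alpha>)"
    using r by real_asymp
  have "(\<lambda>X. summatory b (X + X powr r) - summatory b X) \<in> O(\<lambda>X. of_real (X powr \<beta>))"
    by (intro sum_in_bigo bigo_powr_short_shift sum r)
  then have "(\<lambda>X. norm (summatory b (X + X powr r) - summatory b X)) \<in> O(\<lambda>X. X powr \<beta>)"
    by (subst (asm) landau_o.big.norm_iff[symmetric]) (simp add: bigo_def)
  from landau_o.big.mult[OF 1 this]
  have "G \<in> O(\<lambda>X. X powr (\<alpha> + \<beta>))"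
    unfolding G_def by (cases "K = 0") (simp_all add: powr_add mult_ac \<open>C > 0\<close>)
  also have "(\<lambda>X. X powr (\<alpha> + \<beta>)) \<in> o(\<lambda>X. X powr s)"
    using s by real_asymp
  finally have "((\<lambda>X. G X / X powr s) \<longlongrightarrow> 0) at_top"
    by (rule smalloD_tendsto)
  \<comment> \<open>The value \<open>L / 2\<close> separates the two quotients: the bound
    \<open>G\<close> tends to 0 below it, the sum of squared norms stays above it.\<close>
  then have "\<forall>\<^sub>F X in at_top. G X / X powr s < L / 2"
    using \<open>L > 0\<close> by (intro order_tendstoD(2)) auto
  moreover have "\<forall>\<^sub>F X in at_top. L / 2 < short_sum r (\<lambda>n. (norm (b n))\<^sup>2) X / X powr s"
    using \<open>L > 0\<close> by (intro order_tendstoD(1)[OF lim]) auto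
  ultimately show ?thesis
    using eventually_ge_at_top[of "real N"] eventually_gt_at_top[of 0]
  proof eventually_elim
    case (elim X)
    have "short_sum r (\<lambda>n. (norm (b n))\<^sup>2) X
            \<le> (\<Sum>n | real n \<in> {X<..X + X powr r}. C * (X + X powr r) powr \<alpha> * norm (b n))"
      unfolding short_sum_def
    proof (rule sum_mono)
      fix n assume n: "n \<in> {n. real n \<in> {X<..X + X powr r}}"
      have "norm (b n) \<le> C * real n powr \<alpha>"
        using n elim by (intro N) auto
      \<comment> \<open>Since \<open>\<alpha> \<ge> 0\<close>, the bound at the right endpoint
        serves uniformly for all terms of the interval.\<close>
      also have "\<dots> \<le> C * (X + X powr r) powr \<alpha>"
        using n \<open>C > 0\<close> \<alpha> by (intro mult_left_mono powr_mono2) auto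
      finally show "(norm (b n))\<^sup>2 \<le> C * (X + X powr r) powr \<alpha> * norm (b n)"
        by (simp add: power2_eq_square mult_right_mono)
    qed
    also have "\<dots> = C * (X + X powr r) powr \<alpha> * short_sum r (\<lambda>n. norm (b n)) X"
      unfolding short_sum_def by (rule sum_distrib_left[symmetric])
    finally have *: "short_sum r (\<lambda>n. (norm (b n))\<^sup>2) X
        \<le> C * (X + X powr r) powr \<alpha> * short_sum r (\<lambda>n. norm (b n)) X" .
    show ?case
    proof (rule ccontr)
      assume "\<not> ?case"
      then have "C * (X + X powr r) powr \<alpha> * short_sum r (\<lambda>n. norm (b n)) X \<le> G X"
        using elim \<open>C > 0\<close> unfolding G_def
        by (intro mult_left_mono) (auto simp: short_sum_eq_diff)
      with * have "short_sum r (\<lambda>n. (norm (b n))\<^sup>2) X / X powr s \<le> G X / X powr s"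
        by (intro divide_right_mono) auto
      with elim show False by linarith
    qed
  qed
qed

section \<open>Absence of cancellation inside a sector\<close>

text \<open>Rotation by minus the angle of the bisector makes the sector symmetric about the
  positive real axis. A point at angle \<open>\<phi>\<close> then has real part
  \<open>cos \<phi>\<close> times its norm, and the cosine decreases on \<open>[0, pi]\<close>, so
  the boundary rays are the worst case.\<close>

lemma sector_half_plane:
  assumes "z \<in> sector \<theta>1 \<theta>2" "\<theta>2 - \<theta>1 \<le> 2 * pi"
  shows "cos ((\<theta>2 - \<theta>1) / 2) * norm z \<le> Re (cis (- (\<theta>1 + \<theta>2) / 2) * z)"
proof -
  obtain \<rho> \<theta> where z: "z = of_real \<rho> * cis \<theta>" and "\<rho> > 0" "\<theta>1 \<le> \<theta>" "\<theta> \<le> \<theta>2"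
    using assms(1) unfolding sector_def cis_conv_exp by auto
  let ?\<phi> = "\<theta> - (\<theta>1 + \<theta>2) / 2"
  have "\<bar>?\<phi>\<bar> \<le> (\<theta>2 - \<theta>1) / 2"
    using \<open>\<theta>1 \<le> \<theta>\<close> \<open>\<theta> \<le> \<theta>2\<close> unfolding abs_le_iff by (simp add: field_simps)
  then have "cos ((\<theta>2 - \<theta>1) / 2) \<le> cos \<bar>?\<phi>\<bar>"
    using assms(2) by (intro cos_monotone_0_pi_le) auto
  then have "\<rho> * cos ((\<theta>2 - \<theta>1) / 2) \<le> \<rho> * cos ?\<phi>"
    using \<open>\<rho> > 0\<close> by simp
  also have "\<rho> * cos ?\<phi> = Re (of_real \<rho> * (cis (- (\<theta>1 + \<theta>2) / 2) * cis \<theta>))"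
    unfolding cis_mult by (simp add: field_simps)
  finally show ?thesis
    using \<open>\<rho> > 0\<close> by (simp add: z norm_mult mult_ac)
qed

text \<open>One rotation serves all terms, and the rotated real parts add up without cancellation.
  The half-angle lies below \<open>pi / 2\<close>, so its cosine is positive and can be divided
  by.\<close>

lemma sum_norm_le_norm_sum_sector:
  assumes "\<And>n. n \<in> A \<Longrightarrow> f n \<in> sector \<theta>1 \<theta>2" "0 \<le> \<theta>2 - \<theta>1" "\<theta>2 - \<theta>1 < pi"
  shows "(\<Sum>n\<in>A. norm (f n)) \<le> 1 / cos ((\<theta>2 - \<theta>1) / 2) * norm (\<Sum>n\<in>A. f n)"
proof -
  let ?c = "cos ((\<theta>2 - \<theta>1) / 2)" and ?u = "cis (- (\<theta>1 + \<theta>2) / 2)"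
  have "?c > 0"
    using assms(2,3) by (intro cos_gt_zero_pi) auto
  have "?c * (\<Sum>n\<in>A. norm (f n)) \<le> (\<Sum>n\<in>A. Re (?u * f n))"
    unfolding sum_distrib_left
  proof (rule sum_mono)
    fix n assume "n \<in> A"
    with assms show "?c * norm (f n) \<le> Re (?u * f n)"
      by (intro sector_half_plane) auto
  qed
  also have "\<dots> = Re (?u * (\<Sum>n\<in>A. f n))"
    by (simp only: sum_distrib_left Re_sum)
  also have "\<dots> \<le> norm (?u * (\<Sum>n\<in>A. f n))"
    by (rule complex_Re_le_cmod)
  also have "\<dots> = norm (\<Sum>n\<in>A. f n)"
    by (simp add: norm_mult)
  finally show ?thesis
    using \<open>?c > 0\<close> by (simp add: field_simps)
qed

section \<open>Sign changes of real sequences\<close>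

text \<open>If the interval had no positive or no negative term, the absolute value of the sum would
  equal the sum of absolute values, against the strict inequality with \<open>K = 1\<close>.\<close>

lemma eventually_has_sign_change:
  fixes b :: "nat \<Rightarrow> real" and \<alpha> \<beta> r s L :: real
  assumes "\<alpha> \<ge> 0" "r < 1" "\<alpha> + \<beta> < s" "L \<noteq> 0"
    and "b \<in> O(\<lambda>n. real n powr \<alpha>)" "summatory b \<in> O(\<lambda>X. X powr \<beta>)"
    and "((\<lambda>X. short_sum r (\<lambda>n. (b n)\<^sup>2) X / X powr s) \<longlongrightarrow> L) at_top"
  shows "\<forall>\<^sub>F X in at_top. has_sign_change b {X<..X + X powr r}"
proof -
  have "\<forall>\<^sub>F X in at_top. 1 * norm (short_sum r b X) < short_sum r (\<lambda>n. norm (b n)) X"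
    using assms by (intro short_sum_norm_gt_norm_short_sum[where L = L]) simp_all
  then show ?thesis
  proof eventually_elim
    case (elim X)
    let ?A = "{n. real n \<in> {X<..X + X powr r}}"
    have lt: "\<bar>\<Sum>n\<in>?A. b n\<bar> < (\<Sum>n\<in>?A. \<bar>b n\<bar>)"
      using elim unfolding short_sum_def by simp
    have "\<exists>n\<in>?A. b n > 0"
    proof (rule ccontr)
      assume "\<not> ?thesis"
      then have "(\<Sum>n\<in>?A. \<bar>b n\<bar>) = (\<Sum>n\<in>?A. - b n)"
        by (intro sum.cong) auto
      with lt show False by (simp add: sum_negf)
    qed
    moreover have "\<exists>m\<in>?A. b m < 0"
    proof (rule ccontr)
      assume "\<not> ?thesis"
      then have "(\<Sum>n\<in>?A. \<bar>b n\<bar>) = (\<Sum>n\<in>?A. b n)"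
        by (intro sum.cong) auto
      with lt show False by simp
    qed
    ultimately show ?case
      unfolding has_sign_change_def by blast
  qed
qed

section \<open>Passage to real and imaginary parts\<close>

lemma bigo_Re_Im:
  fixes f :: "'b \<Rightarrow> complex" and g :: "'b \<Rightarrow> real"
  assumes "f \<in> O[F](\<lambda>x. of_real (g x))"
  shows "(\<lambda>x. Re (f x)) \<in> O[F](g)" "(\<lambda>x. Im (f x)) \<in> O[F](g)"
proof -
  have "(\<lambda>x. Re (f x)) \<in> O[F](\<lambda>x. norm (f x))" "(\<lambda>x. Im (f x)) \<in> O[F](\<lambda>x. norm (f x))"
    by (intro landau_o.big_mono always_eventually; simp add: abs_Re_le_cmod abs_Im_le_cmod)+
  moreover have "(\<lambda>x. norm (f x)) \<in> O[F](g)"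
    using assms by (subst (asm) landau_o.big.norm_iff[symmetric]) (simp add: bigo_def)
  ultimately show "(\<lambda>x. Re (f x)) \<in> O[F](g)" "(\<lambda>x. Im (f x)) \<in> O[F](g)"
    using landau_o.big_trans by blast+
qed

lemma summatory_Re: "summatory (\<lambda>n. Re (f n)) X = Re (summatory f X)"
  by (simp add: summatory_def)

lemma summatory_Im: "summatory (\<lambda>n. Im (f n)) X = Im (summatory f X)"
  by (simp add: summatory_def)

lemma short_sum_Re_square:
  "short_sum r (\<lambda>n. (Re (a n))\<^sup>2) X
    = (short_sum r (\<lambda>n. (cmod (a n))\<^sup>2) X + short_sum r (\<lambda>n. Re ((a n)\<^sup>2)) X) / 2"
  unfolding short_sum_def sum.distrib[symmetric] sum_divide_distrib
  by (rule sum.cong) (simp_all add: cmod_power2 Re_power2)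

lemma short_sum_Im_square:
  "short_sum r (\<lambda>n. (Im (a n))\<^sup>2) X
    = (short_sum r (\<lambda>n. (cmod (a n))\<^sup>2) X - short_sum r (\<lambda>n. Re ((a n)\<^sup>2)) X) / 2"
  unfolding short_sum_def sum_subtractf[symmetric] sum_divide_distrib
  by (rule sum.cong) (simp_all add: cmod_power2 Re_power2)

lemma cmod_summatory_square_le:
  "cmod (summatory (\<lambda>n. (a n)\<^sup>2) X) \<le> summatory (\<lambda>n. (cmod (a n))\<^sup>2) X"
  unfolding summatory_def by (rule order.trans[OF norm_sum]) (simp add: norm_power)

section \<open>Comparison of the exponents \<open>\<gamma>1\<close> and
  \<open>\<gamma>2\<close>\<close>

lemma tendsto_powr_asymptotic:
  fixes f :: "real \<Rightarrow> 'a::real_normed_field"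
  assumes "(\<lambda>X. f X - c * of_real (X powr \<gamma>)) \<in> O(\<lambda>X. of_real (X powr \<eta>))" "\<eta> < \<gamma>"
  shows "((\<lambda>X. f X / of_real (X powr \<gamma>)) \<longlongrightarrow> c) at_top"
proof -
  note assms(1)
  also have "(\<lambda>X. of_real (X powr \<eta>) :: 'a) \<in> o(\<lambda>X. of_real (X powr \<gamma>))"
    unfolding landau_o.small.of_real_iff using assms(2) by real_asymp
  finally have "((\<lambda>X. (f X - c * of_real (X powr \<gamma>)) / of_real (X powr \<gamma>)) \<longlongrightarrow> 0) at_top"
    by (rule smalloD_tendsto)
  from tendsto_add[OF this tendsto_const[of c]]
  have "((\<lambda>X. (f X - c * of_real (X powr \<gamma>)) / of_real (X powr \<gamma>) + c) \<longlongrightarrow> c) at_top"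
    by simp
  then show ?thesis
  proof (rule Lim_transform_eventually)
    show "\<forall>\<^sub>F X in at_top. (f X - c * of_real (X powr \<gamma>)) / of_real (X powr \<gamma>) + c
            = f X / of_real (X powr \<gamma>)"
      using eventually_gt_at_top[of 0] by eventually_elim (simp add: field_simps)
  qed
qed

text \<open>Were \<open>\<gamma>2\<close> larger, the sum of \<open>|a(n)|^2\<close> divided by
  \<open>X powr \<gamma>2\<close> would tend to 0. By the triangle inequality so would the sum of
  \<open>a(n)^2\<close>, whose normalised limit is \<open>c2\<close>.\<close>

lemma square_exponent_le:
  fixes a :: "nat \<Rightarrow> complex" and c2 :: complex and c1 \<gamma>1 \<gamma>2 \<eta>1 \<eta>2 :: real
  assumes abs2: "(\<lambda>X. summatory (\<lambda>n. (cmod (a n))\<^sup>2) X - c1 * X powr \<gamma>1) \<in> O(\<lambda>X. X powr \<eta>1)"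
    and sq: "(\<lambda>X. summatory (\<lambda>n. (a n)\<^sup>2) X - c2 * of_real (X powr \<gamma>2))
               \<in> O(\<lambda>X. of_real (X powr \<eta>2))"
    and \<eta>: "\<eta>1 < max \<gamma>2 \<gamma>1" "\<eta>2 < max \<gamma>2 \<gamma>1" and "c2 \<noteq> 0"
  shows "\<gamma>2 \<le> \<gamma>1"
proof (rule ccontr)
  assume "\<not> ?thesis"
  then have "\<gamma>1 < \<gamma>2" "\<eta>1 < \<gamma>2" "\<eta>2 < \<gamma>2"
    using \<eta> by auto
  note abs2
  also have "(\<lambda>X. X powr \<eta>1) \<in> o(\<lambda>X. X powr \<gamma>2)"
    using \<open>\<eta>1 < \<gamma>2\<close> by real_asymp
  finally have "((\<lambda>X. (summatory (\<lambda>n. (cmod (a n))\<^sup>2) X - c1 * X powr \<gamma>1) / X powr \<gamma>2) \<longlongrightarrow> 0) at_top"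
    by (rule smalloD_tendsto)
  moreover have "((\<lambda>X. X powr \<gamma>1 / X powr \<gamma>2) \<longlongrightarrow> 0) at_top"
    using \<open>\<gamma>1 < \<gamma>2\<close> by real_asymp
  ultimately have "((\<lambda>X. (summatory (\<lambda>n. (cmod (a n))\<^sup>2) X - c1 * X powr \<gamma>1) / X powr \<gamma>2
      + c1 * (X powr \<gamma>1 / X powr \<gamma>2)) \<longlongrightarrow> 0 + c1 * 0) at_top"
    by (intro tendsto_intros)
  then have "((\<lambda>X. summatory (\<lambda>n. (cmod (a n))\<^sup>2) X / X powr \<gamma>2) \<longlongrightarrow> 0) at_top"
    by (simp add: diff_divide_distrib)
  then have "((\<lambda>X. summatory (\<lambda>n. (a n)\<^sup>2) X / of_real (X powr \<gamma>2)) \<longlongrightarrow> 0) at_top"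
  proof (rule tendsto_0_le[where K = 1], intro always_eventually allI)
    fix X :: real
    have "cmod (summatory (\<lambda>n. (a n)\<^sup>2) X) \<le> \<bar>summatory (\<lambda>n. (cmod (a n))\<^sup>2) X\<bar>"
      using cmod_summatory_square_le[of a X] by simp
    then show "norm (summatory (\<lambda>n. (a n)\<^sup>2) X / of_real (X powr \<gamma>2))
        \<le> norm (summatory (\<lambda>n. (cmod (a n))\<^sup>2) X / X powr \<gamma>2) * 1"
      by (simp add: norm_divide divide_right_mono)
  qed
  moreover have "((\<lambda>X. summatory (\<lambda>n. (a n)\<^sup>2) X / of_real (X powr \<gamma>2)) \<longlongrightarrow> c2) at_top"
    using sq \<open>\<eta>2 < \<gamma>2\<close> by (rule tendsto_powr_asymptotic)
  ultimately have "c2 = 0"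
    using tendsto_unique[OF trivial_limit_at_top_linorder] by blast
  with \<open>c2 \<noteq> 0\<close> show False ..
qed

section \<open>Terms outside a sector, and sign changes of real and imaginary parts\<close>

theorem theorem2p1:
  fixes a :: "nat \<Rightarrow> complex"
    and \<alpha> \<beta> c1 \<gamma>1 \<eta>1 :: real
  assumes pos: "\<alpha> > 0" "\<beta> > 0" "c1 > 0" "\<gamma>1 > 0" "\<eta>1 > 0"
    and bound: "a \<in> O(\<lambda>n. of_real (real n powr \<alpha>))"
    and sum1: "summatory a \<in> O(\<lambda>X. of_real (X powr \<beta>))"
    and sum_abs2: "(\<lambda>X. summatory (\<lambda>n. (cmod (a n))\<^sup>2) X - c1 * X powr \<gamma>1)
                     \<in> O(\<lambda>X. X powr \<eta>1)"
  shows
    "(\<forall>\<theta>1 \<theta>2 r :: real.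
        0 \<le> \<theta>2 - \<theta>1 \<and> \<theta>2 - \<theta>1 < pi \<and>
        max (\<alpha> + \<beta>) \<eta>1 - (\<gamma>1 - 1) < r \<and> r < 1 \<longrightarrow>
        (\<forall>\<^sub>F X in at_top. \<exists>n. real n \<in> {X<..X + X powr r} \<and> a n \<notin> sector \<theta>1 \<theta>2))
     \<and>
     (\<forall>(c2 :: complex) (\<gamma>2 :: real) (\<eta>2 :: real) (r :: real).
        \<gamma>2 > 0 \<and> \<eta>2 > 0 \<and>
        (c2 = 0 \<longrightarrow> \<gamma>2 \<le> \<gamma>1) \<and>
        (\<lambda>X. summatory (\<lambda>n. (a n)\<^sup>2) X - c2 * of_real (X powr \<gamma>2))
          \<in> O(\<lambda>X. of_real (X powr \<eta>2)) \<and>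
        \<alpha> + \<beta> < max \<gamma>1 \<gamma>2 \<and>
        max (\<alpha> + \<beta>) (max \<eta>2 \<eta>1) - (max \<gamma>2 \<gamma>1 - 1) < r \<and> r < 1 \<longrightarrow>
        (\<not> (\<forall>X>0. Re c2 * X powr \<gamma>2 = - c1 * X powr \<gamma>1) \<longrightarrow>
           (\<forall>\<^sub>F X in at_top. has_sign_change (\<lambda>n. Re (a n)) {X<..X + X powr r})) \<and>
        (\<not> (\<forall>X>0. Re c2 * X powr \<gamma>2 = c1 * X powr \<gamma>1) \<longrightarrow>
           (\<forall>\<^sub>F X in at_top. has_sign_change (\<lambda>n. Im (a n)) {X<..X + X powr r})))"
proof (intro conjI allI impI; (elim conjE)?)
  fix \<theta>1 \<theta>2 r :: real
  assume \<theta>: "0 \<le> \<theta>2 - \<theta>1" "\<theta>2 - \<theta>1 < pi"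
    and lower: "max (\<alpha> + \<beta>) \<eta>1 - (\<gamma>1 - 1) < r" and r: "r < 1"
  \<comment> \<open>The lower bound on \<open>r\<close> says exactly that the order of growth
    \<open>\<gamma>1 - 1 + r\<close> of the short sum of \<open>|a(n)|^2\<close> beats both
    \<open>\<alpha> + \<beta>\<close> and the error exponent.\<close>
  have s: "\<alpha> + \<beta> < \<gamma>1 - 1 + r" "\<eta>1 < \<gamma>1 - 1 + r"
    using lower by auto
  have lim: "((\<lambda>X. short_sum r (\<lambda>n. (cmod (a n))\<^sup>2) X / X powr (\<gamma>1 - 1 + r)) \<longlongrightarrow> c1 * \<gamma>1) at_top"
    using short_sum_powr_limit[OF sum_abs2 r s(2) order.refl] by simp
  have "\<forall>\<^sub>F X in at_top. 1 / cos ((\<theta>2 - \<theta>1) / 2) * norm (short_sum r a X)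
          < short_sum r (\<lambda>n. norm (a n)) X"
    using pos by (intro short_sum_norm_gt_norm_short_sum[OF _ r s(1) _ bound sum1 lim]) auto
  then show "\<forall>\<^sub>F X in at_top. \<exists>n. real n \<in> {X<..X + X powr r} \<and> a n \<notin> sector \<theta>1 \<theta>2"
  proof eventually_elim
    case (elim X)
    show ?case
    proof (rule ccontr)
      assume "\<not> ?case"
      then have "short_sum r (\<lambda>n. norm (a n)) X
          \<le> 1 / cos ((\<theta>2 - \<theta>1) / 2) * norm (short_sum r a X)"
        unfolding short_sum_def by (intro sum_norm_le_norm_sum_sector \<theta>) auto
      with elim show False by simp
    qed
  qed
next
  fix c2 :: complex and \<gamma>2 \<eta>2 r :: real
  assume c2: "c2 = 0 \<longrightarrow> \<gamma>2 \<le> \<gamma>1"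
    and sq: "(\<lambda>X. summatory (\<lambda>n. (a n)\<^sup>2) X - c2 * of_real (X powr \<gamma>2))
               \<in> O(\<lambda>X. of_real (X powr \<eta>2))"
    and lower: "max (\<alpha> + \<beta>) (max \<eta>2 \<eta>1) - (max \<gamma>2 \<gamma>1 - 1) < r" and r: "r < 1"
  \<comment> \<open>Because \<open>r < 1\<close>, the lower bound on \<open>r\<close> puts
    \<open>\<eta>1\<close> and \<open>\<eta>2\<close> below the larger of the two exponents, which
    settles nonzero \<open>c2\<close>. For \<open>c2 = 0\<close> the asymptotic formula leaves
    \<open>\<gamma>2\<close> undetermined, and the implication \<open>c2\<close> supplies the
    claim.\<close>
  have "\<gamma>2 \<le> \<gamma>1"
    using square_exponent_le[OF sum_abs2 sq] c2 lower r by fastforce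
  define s where "s = \<gamma>1 - 1 + r"
  have s: "\<alpha> + \<beta> < s" "\<eta>1 < s" "\<eta>2 < s" "\<gamma>1 - 1 + r \<le> s" "\<gamma>2 - 1 + r \<le> s"
    using lower \<open>\<gamma>2 \<le> \<gamma>1\<close> unfolding s_def by auto
  \<comment> \<open>\<open>M\<close> is the limit of the short sum of
    \<open>Re ((a n)\<^sup>2)\<close> on the scale \<open>X powr s\<close>: for
    \<open>\<gamma>2 < \<gamma>1\<close> that sum is negligible.\<close>
  define M where "M = (if \<gamma>2 = \<gamma>1 then Re c2 * \<gamma>1 else 0)"
  have lim1: "((\<lambda>X. short_sum r (\<lambda>n. (cmod (a n))\<^sup>2) X / X powr s) \<longlongrightarrow> c1 * \<gamma>1) at_top"
    using short_sum_powr_limit[OF sum_abs2 r s(2,4)] by (simp add: s_def)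
  have "(\<lambda>X. summatory (\<lambda>n. Re ((a n)\<^sup>2)) X - Re c2 * X powr \<gamma>2) \<in> O(\<lambda>X. X powr \<eta>2)"
    using bigo_Re_Im(1)[OF sq] by (simp add: summatory_Re)
  from short_sum_powr_limit[OF this r s(3,5)]
  have lim2: "((\<lambda>X. short_sum r (\<lambda>n. Re ((a n)\<^sup>2)) X / X powr s) \<longlongrightarrow> M) at_top"
    unfolding M_def s_def by (simp split: if_splits)
  {
    assume ne: "\<not> (\<forall>X>0. Re c2 * X powr \<gamma>2 = - c1 * X powr \<gamma>1)"
    \<comment> \<open>For equal exponents this is \<open>(c1 + Re c2) * \<gamma>1\<close>, nonzero
      as the two power functions are not identical; otherwise it is
      \<open>c1 * \<gamma>1 > 0\<close>.\<close>
    have "c1 * \<gamma>1 + M \<noteq> 0"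
    proof (cases "\<gamma>2 = \<gamma>1")
      case True
      with ne have "c1 + Re c2 \<noteq> 0"
        by (metis add.commute eq_neg_iff_add_eq_0)
      with True pos show ?thesis
        unfolding M_def by (simp add: distrib_right[symmetric])
    qed (use pos in \<open>simp add: M_def\<close>)
    moreover have "((\<lambda>X. short_sum r (\<lambda>n. (Re (a n))\<^sup>2) X / X powr s) \<longlongrightarrow> (c1 * \<gamma>1 + M) / 2) at_top"
      unfolding short_sum_Re_square
      using tendsto_divide[OF tendsto_add[OF lim1 lim2] tendsto_const[of 2]]
      by (simp add: add_divide_distrib mult.commute)
    moreover have "summatory (\<lambda>n. Re (a n)) \<in> O(\<lambda>X. X powr \<beta>)"
      using bigo_Re_Im(1)[OF sum1] by (simp add: summatory_Re[abs_def])
    ultimately show "\<forall>\<^sub>F X in at_top. has_sign_change (\<lambda>n. Re (a n)) {X<..X + X powr r}"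
      using pos r s(1) bigo_Re_Im(1)[OF bound]
      by (intro eventually_has_sign_change[where s = s and L = "(c1 * \<gamma>1 + M) / 2"]) auto
  next
    assume ne: "\<not> (\<forall>X>0. Re c2 * X powr \<gamma>2 = c1 * X powr \<gamma>1)"
    \<comment> \<open>The sign of \<open>M\<close> flips for imaginary parts, so for equal exponents
      the excluded coincidence is \<open>Re c2 = c1\<close>.\<close>
    have "c1 * \<gamma>1 - M \<noteq> 0"
    proof (cases "\<gamma>2 = \<gamma>1")
      case True
      with ne have "c1 \<noteq> Re c2"
        by metis
      with True pos show ?thesis
        unfolding M_def by simp
    qed (use pos in \<open>simp add: M_def\<close>)
    moreover have "((\<lambda>X. short_sum r (\<lambda>n. (Im (a n))\<^sup>2) X / X powr s) \<longlongrightarrow> (c1 * \<gamma>1 - M) / 2) at_top"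
      unfolding short_sum_Im_square
      using tendsto_divide[OF tendsto_diff[OF lim1 lim2] tendsto_const[of 2]]
      by (simp add: diff_divide_distrib mult.commute)
    moreover have "summatory (\<lambda>n. Im (a n)) \<in> O(\<lambda>X. X powr \<beta>)"
      using bigo_Re_Im(2)[OF sum1] by (simp add: summatory_Im[abs_def])
    ultimately show "\<forall>\<^sub>F X in at_top. has_sign_change (\<lambda>n. Im (a n)) {X<..X + X powr r}"
      using pos r s(1) bigo_Re_Im(2)[OF bound]
      by (intro eventually_has_sign_change[where s = s and L = "(c1 * \<gamma>1 - M) / 2"]) auto
  }
qed

end
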